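(* Let $\alpha,\beta$ be two multiplicatively independent real numbers greater than $1$. Then there exist nearly linear recurrence sequences $(a_n)_{n\ge0}$, $(b_n)_{n\ge0}$ with all terms in $\mathbb{Z}$, whose characteristic polynomials have dominating roots $\alpha$ and $\beta$ respectively, such that there are infinitely many pairs of non-negative integers $(k,m)$ with $a_k=b_m$. Moreover, this set of pairs $(k,m)$ has finite intersection with every rational line.
   Context: A sequence $(a_n)_{n\ge 0}$ of complex numbers is a nearly linear recurrence sequence if there exist an integer $d\ge 0$ and complex numbers $A_0,\dots,A_{d-1}$ such that $(a_{n+d}+A_{d-1}a_{n+d-1}+\cdots+A_0a_n)_{n\ge 0}$ is bounded. The set of polynomials $B_tx^t+\cdots+B_0\in\mathbb{C}[x]$ such that $(\sum_{i=0}^t B_ia_{n+i})_{n\ge 0}$ is bounded is an ideal of $\mathbb{C}[x]$; its unique monic generator is the characteristic polynomial. Nonzero complex $\alpha,\beta$ are multiplicatively dependent if $\alpha^m\beta^n=1$ for some integers $m,n$ not both zero, and multiplicatively independent otherwise. A root $\alpha$ of a polynomial $P$ is dominating if $|\alpha|>|\beta|$ for every other root $\beta$ of $P$. A rational line is a set $\{(k,m)\in\mathbb{Z}^2: k,m\ge K_0,\ Ak+Bm+C=0\}$ with $K_0\ge 0$ a constant and $A,B,C$ rational numbers, $A,B$ not both zero. *)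

theory Defs
  imports Complex_Main "HOL-Computational_Algebra.Polynomial"
begin

definition nearly_linear_recurrence :: "(nat \<Rightarrow> complex) \<Rightarrow> bool" where
  "nearly_linear_recurrence a \<longleftrightarrow>
     (\<exists>(d::nat) (A :: nat \<Rightarrow> complex). Bseq (\<lambda>n. a (n + d) + (\<Sum>i<d. A i * a (n + i))))"

definition poly_shift :: "complex poly \<Rightarrow> (nat \<Rightarrow> complex) \<Rightarrow> nat \<Rightarrow> complex" where
  "poly_shift P a n = (\<Sum>i\<le>degree P. coeff P i * a (n + i))"

definition bounding_ideal :: "(nat \<Rightarrow> complex) \<Rightarrow> complex poly set" where
  "bounding_ideal a = {P. Bseq (poly_shift P a)}"

text \<open>The definite description is meaningful only for nearly linear recurrence sequences
  (otherwise the ideal is zero and has no monic generator); see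
  \<open>characteristic_poly_ex1\<close> below.\<close>

definition characteristic_poly :: "(nat \<Rightarrow> complex) \<Rightarrow> complex poly" where
  "characteristic_poly a =
     (THE P. lead_coeff P = 1 \<and> bounding_ideal a = {P * Q | Q. True})"

definition multiplicatively_dependent :: "complex \<Rightarrow> complex \<Rightarrow> bool" where
  "multiplicatively_dependent x y \<longleftrightarrow>
     x \<noteq> 0 \<and> y \<noteq> 0 \<and> (\<exists>m n :: int. (m \<noteq> 0 \<or> n \<noteq> 0) \<and> x powi m * y powi n = 1)"

definition multiplicatively_independent :: "complex \<Rightarrow> complex \<Rightarrow> bool" where
  "multiplicatively_independent x y \<longleftrightarrow>
     x \<noteq> 0 \<and> y \<noteq> 0 \<and> \<not> multiplicatively_dependent x y"

text \<open>``Other root'' means a root different from \<open>x\<close> as a number; the multiplicity of \<open>x\<close>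
  is not restricted.\<close>

definition dominating_root :: "complex poly \<Rightarrow> complex \<Rightarrow> bool" where
  "dominating_root P x \<longleftrightarrow>
     poly P x = 0 \<and> (\<forall>y. poly P y = 0 \<and> y \<noteq> x \<longrightarrow> cmod x > cmod y)"

definition rational_line :: "(int \<times> int) set \<Rightarrow> bool" where
  "rational_line L \<longleftrightarrow>
     (\<exists>(K\<^sub>0::real) (A::rat) (B::rat) (C::rat). K\<^sub>0 \<ge> 0 \<and> (A \<noteq> 0 \<or> B \<noteq> 0) \<and>
        L = {(k, m). of_int k \<ge> K\<^sub>0 \<and> of_int m \<ge> K\<^sub>0 \<and> A * of_int k + B * of_int m + C = 0})"

lemma poly_shift_extend:
  assumes "degree P \<le> N"
  shows "poly_shift P a n = (\<Sum>i\<le>N. coeff P i * a (n + i))"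
  unfolding poly_shift_def using assms
  by (intro sum.mono_neutral_left) (auto simp: coeff_eq_0)

lemma poly_shift_0 [simp]: "poly_shift 0 a n = 0"
  by (simp add: poly_shift_def)

lemma poly_shift_add: "poly_shift (P + Q) a n = poly_shift P a n + poly_shift Q a n"
proof -
  define N where "N = max (degree P) (degree Q)"
  have "degree P \<le> N" "degree Q \<le> N" "degree (P + Q) \<le> N"
    by (auto simp: N_def degree_add_le)
  thus ?thesis
    by (simp add: poly_shift_extend[of _ N] sum.distrib algebra_simps)
qed

lemma poly_shift_smult: "poly_shift (smult c P) a n = c * poly_shift P a n"
  by (simp add: poly_shift_extend[of "smult c P" "degree P"] poly_shift_extend[of P "degree P"]
      degree_smult_le sum_distrib_left mult.assoc)

lemma poly_shift_pCons: "poly_shift (pCons c P) a n = c * a n + poly_shift P a (Suc n)"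
proof -
  have "poly_shift (pCons c P) a n = (\<Sum>i\<le>Suc (degree P). coeff (pCons c P) i * a (n + i))"
    by (intro poly_shift_extend degree_pCons_le)
  also have "\<dots> = c * a n + (\<Sum>i\<le>degree P. coeff P i * a (Suc n + i))"
    by (subst sum.atMost_Suc_shift) simp
  finally show ?thesis by (simp add: poly_shift_def)
qed

lemma poly_shift_mult: "poly_shift (P * Q) a n = poly_shift P (poly_shift Q a) n"
proof (induction P arbitrary: n)
  case 0
  show ?case by simp
next
  case (pCons c P)
  show ?case
    by (simp add: poly_shift_add poly_shift_smult poly_shift_pCons pCons.IH)
qed

lemma Bseq_poly_shift:
  assumes "Bseq a"
  shows "Bseq (poly_shift P a)"
proof -
  obtain K where K: "\<And>n. cmod (a n) \<le> K"
    using assms by (auto simp: Bseq_def)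
  have "cmod (poly_shift P a n) \<le> (\<Sum>i\<le>degree P. cmod (coeff P i) * K)" for n
    unfolding poly_shift_def
    by (rule order.trans[OF norm_sum], rule sum_mono) (auto simp: norm_mult intro!: mult_left_mono K)
  thus ?thesis by (rule BseqI')
qed

lemma bounding_ideal_mult: "Q \<in> bounding_ideal a \<Longrightarrow> P * Q \<in> bounding_ideal a"
  using Bseq_poly_shift[of "poly_shift Q a" P]
  by (simp add: bounding_ideal_def poly_shift_mult[abs_def])

lemma bounding_ideal_add:
  assumes "P \<in> bounding_ideal a" "Q \<in> bounding_ideal a"
  shows "P + Q \<in> bounding_ideal a"
proof -
  obtain K L where "\<And>n. cmod (poly_shift P a n) \<le> K" "\<And>n. cmod (poly_shift Q a n) \<le> L"
    using assms by (auto simp: bounding_ideal_def Bseq_def)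
  hence "cmod (poly_shift (P + Q) a n) \<le> K + L" for n
    unfolding poly_shift_add by (intro norm_triangle_mono) auto
  thus ?thesis unfolding bounding_ideal_def by (auto intro: BseqI')
qed

lemma nearly_linear_recurrence_iff:
  "nearly_linear_recurrence a \<longleftrightarrow> (\<exists>P\<in>bounding_ideal a. lead_coeff P = 1)"
proof
  assume "nearly_linear_recurrence a"
  then obtain d A where dA: "Bseq (\<lambda>n. a (n + d) + (\<Sum>i<d. A i * a (n + i)))"
    by (auto simp: nearly_linear_recurrence_def)
  define P where "P = monom 1 d + (\<Sum>i<d. monom (A i) i)"
  have c: "coeff P j = (if j = d then 1 else if j < d then A j else 0)" for j
    by (auto simp: P_def coeff_sum coeff_monom)
  have deg: "degree P = d"
    by (intro antisym degree_le le_degree) (auto simp: c)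
  have "poly_shift P a = (\<lambda>n. a (n + d) + (\<Sum>i<d. A i * a (n + i)))"
    by (auto simp: fun_eq_iff poly_shift_def deg c lessThan_Suc_atMost[symmetric] intro!: sum.cong)
  thus "\<exists>P\<in>bounding_ideal a. lead_coeff P = 1"
    using dA by (intro bexI[of _ P]) (auto simp: bounding_ideal_def deg c)
next
  assume "\<exists>P\<in>bounding_ideal a. lead_coeff P = 1"
  then obtain P where P: "Bseq (poly_shift P a)" "lead_coeff P = 1"
    by (auto simp: bounding_ideal_def)
  have "poly_shift P a = (\<lambda>n. a (n + degree P) + (\<Sum>i<degree P. coeff P i * a (n + i)))"
    using P(2) by (auto simp: fun_eq_iff poly_shift_def lessThan_Suc_atMost[symmetric])
  thus "nearly_linear_recurrence a"
    using P(1) unfolding nearly_linear_recurrence_def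
    by (intro exI[of _ "degree P"] exI[of _ "coeff P"]) simp
qed

lemma characteristic_poly_ex1:
  assumes "nearly_linear_recurrence a"
  shows "\<exists>!P. lead_coeff P = 1 \<and> bounding_ideal a = {P * Q | Q. True}"
proof -
  let ?S = "\<lambda>P. P \<in> bounding_ideal a \<and> lead_coeff P = 1"
  obtain P0 where "?S P0"
    using assms by (auto simp: nearly_linear_recurrence_iff)
  then obtain P where P: "?S P" and least: "\<And>Q. ?S Q \<Longrightarrow> degree P \<le> degree Q"
    using ex_has_least_nat[of ?S P0 degree] by blast
  have dvd: "P dvd Q" if Q: "Q \<in> bounding_ideal a" for Q
  proof (rule ccontr)
    assume "\<not> P dvd Q"
    define R where "R = Q mod P"
    have "R \<noteq> 0" using \<open>\<not> P dvd Q\<close> by (simp add: R_def dvd_eq_mod_eq_0)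
    have "P \<noteq> 0" using P by auto
    have "R = Q + (- (Q div P)) * P"
      by (simp add: R_def minus_div_mult_eq_mod[symmetric])
    hence "R \<in> bounding_ideal a"
      using Q P by (metis bounding_ideal_add bounding_ideal_mult)
    hence "?S (smult (inverse (lead_coeff R)) R)"
      using bounding_ideal_mult[of R a "[:inverse (lead_coeff R):]"] \<open>R \<noteq> 0\<close> by simp
    from least[OF this] have "degree P \<le> degree R"
      using \<open>R \<noteq> 0\<close> by simp
    moreover have "degree R < degree P"
      using degree_mod_less'[of P Q] \<open>P \<noteq> 0\<close> \<open>R \<noteq> 0\<close> by (simp add: R_def)
    ultimately show False by simp
  qed
  have eq: "bounding_ideal a = {P * Q | Q. True}"
    using dvd P bounding_ideal_mult[of P a] by (auto simp: dvd_def mult.commute)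
  show ?thesis
  proof (rule ex1I[of _ P])
    show "lead_coeff P = 1 \<and> bounding_ideal a = {P * Q | Q. True}"
      using P eq by simp
  next
    fix P' assume P': "lead_coeff P' = 1 \<and> bounding_ideal a = {P' * Q | Q. True}"
    have "P' \<in> bounding_ideal a" using P' by (auto intro!: exI[of _ 1])
    moreover have "P' dvd P" using P P' by auto
    moreover have "P dvd P'" using dvd \<open>P' \<in> bounding_ideal a\<close> .
    ultimately obtain c where c: "P' = P * c" "P = P' * (P div P')"
      by (metis dvd_def dvd_mult_div_cancel)
    have nz: "P \<noteq> 0" "P' \<noteq> 0" using P P' by auto
    have "c * (P div P') = 1"
      using c nz by (metis mult.assoc mult_cancel_left mult.right_neutral)
    hence "is_unit c" by (metis dvd_triv_left)
    then obtain k where "c = [:k:]" by (auto simp: is_unit_poly_iff)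
    thus "P' = P" using c(1) P P' nz by (auto simp: lead_coeff_mult)
  qed
qed

end

theory Submission
  imports Defs "HOL-Analysis.Kronecker_Approximation_Theorem"
begin

text \<open>
  A sequence \<open>\<xi> * \<alpha> ^ n + O(1)\<close> with \<open>\<xi> \<noteq> 0\<close> and \<open>\<alpha> > 1\<close> has characteristic polynomial
  \<open>X - \<alpha>\<close>, so rounding such sequences gives integer sequences with dominating root \<open>\<alpha>\<close>.
  By Kronecker's theorem the numbers \<open>m * ln \<beta> - k * ln \<alpha>\<close> are dense in the reals,
  hence by Baire's theorem some \<open>\<xi> > 0\<close> satisfies \<open>\<bar>\<xi> * \<alpha> ^ k - \<beta> ^ m\<bar> < 1\<close> for infinitely
  many pairs. Put \<open>b m = \<lfloor>\<beta> ^ m\<rfloor>\<close> and let \<open>a k\<close> equal \<open>b m\<close> for such pairs and \<open>\<lfloor>\<xi> * \<alpha> ^ k\<rfloor>\<close>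
  otherwise. Whenever \<open>a k = b m\<close>, the difference \<open>k * ln \<alpha> - m * ln \<beta>\<close> is bounded,
  whereas it is unbounded along a rational line since \<open>ln \<alpha> / ln \<beta>\<close> is irrational.
\<close>

text \<open>Shifting by \<open>P\<close> multiplies the geometric part by \<open>poly P z\<close>
  and keeps the bounded error bounded. Since \<open>cmod z > 1\<close> and \<xi> is nonzero,
  boundedness holds exactly when that factor vanishes.\<close>

lemma bounding_ideal_nearly_geometric:
  fixes a :: "nat \<Rightarrow> complex" and \<xi> z :: complex
  assumes a: "Bseq (\<lambda>n. a n - \<xi> * z ^ n)" and "\<xi> \<noteq> 0" and z: "cmod z > 1"
  shows "P \<in> bounding_ideal a \<longleftrightarrow> poly P z = 0"
proof -
  define e where "e n = a n - \<xi> * z ^ n" for n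
  have shift: "poly_shift P a n = \<xi> * poly P z * z ^ n + poly_shift P e n" for n
    by (simp add: poly_shift_def e_def poly_altdef sum_distrib_left sum_distrib_right
        sum.distrib[symmetric] power_add algebra_simps)
  have e: "Bseq (poly_shift P e)"
    using a unfolding e_def[symmetric] by (rule Bseq_poly_shift)
  show ?thesis
  proof
    assume "poly P z = 0"
    then show "P \<in> bounding_ideal a"
      using e by (simp add: bounding_ideal_def shift[abs_def])
  next
    assume "P \<in> bounding_ideal a"
    then have "Bseq (poly_shift P a)" by (simp add: bounding_ideal_def)
    with e obtain K L where "\<And>n. cmod (poly_shift P a n) \<le> K" "\<And>n. cmod (poly_shift P e n) \<le> L"
      by (auto simp: Bseq_def)
    then have bnd: "cmod (poly_shift P a n - poly_shift P e n) \<le> K + L" for n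
      by (rule norm_triangle_le_diff[OF add_mono])
    show "poly P z = 0"
    proof (rule ccontr)
      assume "poly P z \<noteq> 0"
      define c where "c = cmod (\<xi> * poly P z)"
      have c: "c > 0" using \<open>poly P z \<noteq> 0\<close> \<open>\<xi> \<noteq> 0\<close> by (simp add: c_def)
      obtain n where "(K + L) / c < cmod z ^ n" using real_arch_pow[OF z] by blast
      then have "K + L < c * cmod z ^ n" using c by (simp add: field_simps)
      also have "\<dots> = cmod (poly_shift P a n - poly_shift P e n)"
        by (simp add: shift c_def norm_mult norm_power)
      finally show False using bnd[of n] by simp
    qed
  qed
qed

text \<open>The polynomials vanishing at \<open>z\<close> are the multiples of X - z; uniqueness of
  the monic generator then evaluates the definite description.\<close>

lemma nearly_geometric:
  fixes a :: "nat \<Rightarrow> complex" and \<xi> z :: complex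
  assumes "Bseq (\<lambda>n. a n - \<xi> * z ^ n)" "\<xi> \<noteq> 0" "cmod z > 1"
  shows nearly_linear_recurrence_nearly_geometric: "nearly_linear_recurrence a"
    and characteristic_poly_nearly_geometric: "characteristic_poly a = [:-z, 1:]"
proof -
  note ideal = bounding_ideal_nearly_geometric[OF assms]
  show *: "nearly_linear_recurrence a"
    unfolding nearly_linear_recurrence_iff by (rule bexI[of _ "[:-z, 1:]"]) (auto simp: ideal)
  have "bounding_ideal a = {[:-z, 1:] * Q | Q. True}"
    by (auto simp: ideal poly_eq_0_iff_dvd dvd_def)
  then show "characteristic_poly a = [:-z, 1:]"
    unfolding characteristic_poly_def by (intro the1_equality characteristic_poly_ex1 *) auto
qed

lemma dominating_root_linear: "dominating_root [:-z, 1:] z"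
  by (auto simp: dominating_root_def)

text \<open>Exponentiating a linear relation between the logarithms gives a multiplicative one. This
  yields both the irrationality of \<open>ln \<alpha> / ln \<beta>\<close> and the transversality to
  rational lines.\<close>

lemma multiplicatively_independent_ln:
  fixes \<alpha> \<beta> :: real and p q :: int
  assumes "\<alpha> > 1" "\<beta> > 1"
    and "multiplicatively_independent (complex_of_real \<alpha>) (complex_of_real \<beta>)"
    and "p \<noteq> 0 \<or> q \<noteq> 0"
  shows "of_int p * ln \<alpha> + of_int q * ln \<beta> \<noteq> 0"
proof
  assume "of_int p * ln \<alpha> + of_int q * ln \<beta> = 0"
  then have "exp (of_int p * ln \<alpha>) * exp (of_int q * ln \<beta>) = 1"
    by (simp flip: exp_add)
  then have "\<alpha> powi p * \<beta> powi q = 1"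
    using assms(1,2) by (simp add: powr_def flip: powr_real_of_int')
  then have "complex_of_real (\<alpha> powi p * \<beta> powi q) = 1" by simp
  then have "complex_of_real \<alpha> powi p * complex_of_real \<beta> powi q = 1"
    by (simp add: of_real_power_int)
  with assms show False
    by (auto simp: multiplicatively_independent_def multiplicatively_dependent_def)
qed

text \<open>This is the density of fractional parts of multiples of \<open>u / v\<close>, scaled by
  \<open>v\<close>. The multipliers become exponents, hence must be natural; large \<open>k\<close>
  is what later gives infinitely many pairs.\<close>

lemma nat_multiples_dense:
  fixes u v t \<epsilon> :: real
  assumes "u > 0" "v > 0" and irrat: "u / v \<notin> \<rat>" and "\<epsilon> > 0"
  shows "\<exists>k\<ge>N. \<exists>m::nat. \<bar>t - (real m * v - real k * u)\<bar> < \<epsilon>"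
proof -
  \<comment> \<open>Shifting by \<open>M\<close> makes \<open>k\<close> large, and thereby the integer \<open>h\<close> nonnegative.\<close>
  obtain M :: nat where M: "M \<ge> N" "real M * u > \<epsilon> - t"
  proof -
    obtain M0 :: nat where "real M0 * u > \<epsilon> - t" using ex_less_of_nat_mult[OF \<open>u > 0\<close>] by blast
    moreover have "real (max M0 N) * u \<ge> real M0 * u" using \<open>u > 0\<close> by (intro mult_right_mono) auto
    ultimately show ?thesis using that[of "max M0 N"] by linarith
  qed
  \<comment> \<open>The target is chosen so that scaling by \<open>v\<close> and adding
    \<open>M\<close> to \<open>k\<close> leaves an approximation of \<open>t\<close>.\<close>
  obtain h k :: int where k: "k > 0" and
    hk: "\<bar>of_int k * (u / v) - of_int h - (- (t + real M * u) / v)\<bar> < \<epsilon> / v"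
    using sequence_of_fractional_parts_is_dense[OF irrat divide_pos_pos[OF \<open>\<epsilon> > 0\<close> \<open>v > 0\<close>]] .
  have "\<bar>of_int k * u - of_int h * v + (t + real M * u)\<bar> < \<epsilon>"
  proof -
    have "of_int k * u - of_int h * v + (t + real M * u)
      = v * (of_int k * (u / v) - of_int h - (- (t + real M * u) / v))"
      using \<open>v > 0\<close> by (simp add: field_simps)
    then show ?thesis
      using mult_strict_left_mono[OF hk \<open>v > 0\<close>] \<open>v > 0\<close> by (simp only: abs_mult) simp
  qed
  then have main: "\<bar>t - (of_int h * v - (of_int k + real M) * u)\<bar> < \<epsilon>"
    by (simp add: algebra_simps)
  moreover have "of_int k * u > 0" using k \<open>u > 0\<close> by simp
  ultimately have "of_int h * v > 0" using M by (simp add: abs_less_iff algebra_simps)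
  then have "h > 0" using \<open>v > 0\<close> by (simp add: zero_less_mult_iff)
  then show ?thesis
    using main k M by (intro exI[of _ "nat k + M"] conjI exI[of _ "nat h"]) auto
qed

text \<open>With \<xi> written as \<open>exp t\<close>, positivity is automatic, and for each
  \<open>N\<close> the admissible \<open>t\<close> form an open dense set; Baire's theorem gives a
  \<open>t\<close> common to all \<open>N\<close>.\<close>

lemma simultaneous_power_approx:
  fixes \<alpha> \<beta> :: real
  assumes "\<alpha> > 1" "\<beta> > 1" and irrat: "ln \<alpha> / ln \<beta> \<notin> \<rat>"
  shows "\<exists>\<xi>>0. \<forall>N. \<exists>k\<ge>N. \<exists>m. \<bar>\<xi> * \<alpha> ^ k - \<beta> ^ m\<bar> < 1"
proof -
  define G where "G N = (\<Union>k\<in>{N..}. \<Union>m. {t. \<bar>exp t * \<alpha> ^ k - \<beta> ^ m\<bar> < 1})" for N :: nat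
  have "open (G N)" for N
    unfolding G_def by (intro open_UN ballI open_Collect_less continuous_intros)
  moreover have "UNIV \<subseteq> closure (G N)" for N
  proof
    fix t :: real
    have "\<exists>s\<in>G N. dist s t < \<epsilon>" if "\<epsilon> > 0" for \<epsilon>
    proof -
      obtain k m where k: "k \<ge> N" and km: "\<bar>t - (real m * ln \<beta> - real k * ln \<alpha>)\<bar> < \<epsilon>"
        using nat_multiples_dense[OF ln_gt_zero[OF assms(1)] ln_gt_zero[OF assms(2)] irrat \<open>\<epsilon> > 0\<close>]
        by meson
      \<comment> \<open>At such \<open>s\<close> the difference of the two powers vanishes exactly,
        so the dense points all lie in \<open>G N\<close>.\<close>
      define s where "s = real m * ln \<beta> - real k * ln \<alpha>"
      have "exp s * \<alpha> ^ k = \<beta> ^ m"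
        using assms by (simp add: s_def exp_diff exp_of_nat_mult)
      then have "s \<in> G N" using k by (auto simp: G_def intro!: bexI[of _ k] exI[of _ m])
      then show ?thesis using km by (auto simp: s_def dist_real_def abs_minus_commute)
    qed
    then show "t \<in> closure (G N)" by (auto simp: closure_approachable)
  qed
  ultimately have "UNIV \<subseteq> closure (\<Inter>(range G))"
    by (intro Baire) auto
  then obtain t where t: "\<And>N. t \<in> G N"
    by (metis INT_E UNIV_I closure_empty empty_iff equals0I subset_empty)
  show ?thesis
    using t by (intro exI[of _ "exp t"]) (auto simp: G_def Bex_def)
qed

text \<open>As \<open>x\<close> and \<open>y\<close> are at least 1, the additive error
  \<open>C\<close> is at most \<open>C * x\<close> and \<open>C * y\<close>, so it can be absorbed
  into constant factors before taking logarithms.\<close>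

lemma ln_diff_bounded:
  fixes x y \<xi> C :: real
  assumes "\<bar>\<xi> * x - y\<bar> \<le> C" "\<xi> > 0" "x \<ge> 1" "y \<ge> 1"
  shows "\<bar>ln x - ln y\<bar> \<le> \<bar>ln (\<xi> + C)\<bar> + \<bar>ln ((1 + C) / \<xi>)\<bar>"
proof -
  have "C \<ge> 0" using assms(1) by linarith
  have Cx: "C \<le> C * x" and Cy: "C \<le> C * y"
    using \<open>C \<ge> 0\<close> assms(3,4) by (auto simp: mult_le_cancel_left1)
  have "y \<le> (\<xi> + C) * x" using assms(1) Cx by (simp add: algebra_simps)
  then have "ln y \<le> ln ((\<xi> + C) * x)" using assms \<open>C \<ge> 0\<close> by (subst ln_le_cancel_iff) auto
  then have 1: "ln y \<le> ln (\<xi> + C) + ln x" using assms \<open>C \<ge> 0\<close> by (simp add: ln_mult)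
  have "\<xi> * x \<le> (1 + C) * y" using assms(1) Cy by (simp add: algebra_simps)
  then have "x \<le> (1 + C) / \<xi> * y" using assms by (simp add: field_simps)
  then have "ln x \<le> ln ((1 + C) / \<xi> * y)" using assms \<open>C \<ge> 0\<close> by (subst ln_le_cancel_iff) auto
  also have "\<dots> = ln ((1 + C) / \<xi>) + ln y" using assms \<open>C \<ge> 0\<close> by (intro ln_mult_pos) auto
  finally show ?thesis using 1 by linarith
qed

text \<open>The condition \<open>AB\<close> says that the line is not parallel to the strip, so
  their intersection is bounded.\<close>

lemma finite_strip_line:
  fixes u v D A B C :: real
  assumes "u > 0" "v > 0" and AB: "B * u + A * v \<noteq> 0"
  shows "finite {(k::nat, m::nat). \<bar>real k * u - real m * v\<bar> \<le> D \<and> A * real k + B * real m + C = 0}"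
    (is "finite ?S")
proof -
  define c where "c = \<bar>B * u + A * v\<bar>"
  have c: "c > 0" using AB by (simp add: c_def)
  define K where "K = (\<bar>B\<bar> * D + \<bar>C * v\<bar>) / c"
  define M where "M = (D + K * u) / v"
  have "real k \<le> K \<and> real m \<le> M" if km: "(k, m) \<in> ?S" for k m
  proof -
    have d: "\<bar>real k * u - real m * v\<bar> \<le> D" and l: "B * real m = - C - A * real k"
      using km by auto
    \<comment> \<open>This eliminates \<open>m\<close> without dividing by \<open>B\<close>, which
      may be zero.\<close>
    have "B * (real k * u - real m * v) = real k * (B * u + A * v) + C * v"
      using arg_cong[OF l, of "\<lambda>x. x * v"] by (simp add: algebra_simps)
    moreover have "\<bar>B * (real k * u - real m * v)\<bar> \<le> \<bar>B\<bar> * D"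
      using d by (simp add: abs_mult mult_left_mono)
    ultimately have "\<bar>real k * (B * u + A * v)\<bar> \<le> \<bar>B\<bar> * D + \<bar>C * v\<bar>" by linarith
    then have k: "real k \<le> K"
      using c unfolding K_def by (subst pos_le_divide_eq) (simp_all add: c_def abs_mult)
    have "real m * v \<le> D + real k * u" using d by linarith
    also have "\<dots> \<le> D + K * u" using k \<open>u > 0\<close> by simp
    finally show ?thesis using k \<open>v > 0\<close> by (simp add: M_def field_simps)
  qed
  then have "?S \<subseteq> {..nat \<lfloor>K\<rfloor>} \<times> {..nat \<lfloor>M\<rfloor>}"
    by (fastforce simp: le_nat_floor)
  then show ?thesis by (rule finite_subset) auto
qed

text \<open>Clearing denominators makes the coefficients usable as integer exponents in a
  multiplicative relation.\<close>

lemma rational_line_int_coeffs: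
  assumes "rational_line L"
  obtains A B C :: int where "A \<noteq> 0 \<or> B \<noteq> 0" "\<And>k m. (k, m) \<in> L \<Longrightarrow> A * k + B * m + C = 0"
proof -
  obtain A B C :: rat where AB: "A \<noteq> 0 \<or> B \<noteq> 0"
    and L: "\<And>k m. (k, m) \<in> L \<Longrightarrow> A * of_int k + B * of_int m + C = 0"
    using assms unfolding rational_line_def by auto
  obtain a a' b b' c c' :: int where a: "A = of_int a / of_int a'" "a' > 0"
    and b: "B = of_int b / of_int b'" "b' > 0" and c: "C = of_int c / of_int c'" "c' > 0"
    by (metis Fract_of_int_quotient Rat_cases)
  show thesis
  proof (rule that)
    show "a * b' * c' \<noteq> 0 \<or> b * a' * c' \<noteq> 0" using AB a b c by auto
    fix k m assume "(k, m) \<in> L"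
    from L[OF this] have "rat_of_int (a * b' * c' * k + b * a' * c' * m + c * a' * b') = of_int 0"
      using a(2) b(2) c(2) by (simp add: a b c field_simps)
    then show "a * b' * c' * k + b * a' * c' * m + c * a' * b' = 0"
      by (simp only: of_int_eq_iff)
  qed
qed

theorem theorem3:
  fixes \<alpha> \<beta> :: real
  assumes "\<alpha> > 1" "\<beta> > 1"
    and "multiplicatively_independent (complex_of_real \<alpha>) (complex_of_real \<beta>)"
  shows "\<exists>a b :: nat \<Rightarrow> complex.
    nearly_linear_recurrence a \<and> nearly_linear_recurrence b \<and>
    range a \<subseteq> \<int> \<and> range b \<subseteq> \<int> \<and>
    dominating_root (characteristic_poly a) (complex_of_real \<alpha>) \<and>
    dominating_root (characteristic_poly b) (complex_of_real \<beta>) \<and>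
    infinite {(k, m). a k = b m} \<and>
    (\<forall>L. rational_line L \<longrightarrow> finite ({(int k, int m) | k m. a k = b m} \<inter> L))"
proof -
  note indep = multiplicatively_independent_ln[OF assms]
  have pos: "ln \<alpha> > 0" "ln \<beta> > 0" using assms by auto
  have "ln \<alpha> / ln \<beta> \<notin> \<rat>"
  proof
    assume "ln \<alpha> / ln \<beta> \<in> \<rat>"
    then obtain p q :: int where "q > 0" "ln \<alpha> / ln \<beta> = of_int p / of_int q"
      by (metis Rats_cases')
    then have "of_int q * ln \<alpha> + of_int (- p) * ln \<beta> = 0"
      using pos by (simp add: field_simps)
    with indep[of q "-p"] \<open>q > 0\<close> show False by simp
  qed
  then obtain \<xi> where \<xi>: "\<xi> > 0" and approx: "\<And>N. \<exists>k\<ge>N. \<exists>m. \<bar>\<xi> * \<alpha> ^ k - \<beta> ^ m\<bar> < 1"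
    using simultaneous_power_approx[of \<alpha> \<beta>] assms by blast
  define close where "close k m \<longleftrightarrow> \<bar>\<xi> * \<alpha> ^ k - \<beta> ^ m\<bar> < 1" for k m
  define b where "b m = \<lfloor>\<beta> ^ m\<rfloor>" for m
  \<comment> \<open>One close index suffices for each \<open>k\<close>, since infinitely many
    \<open>k\<close> have one.\<close>
  define a where "a k = (if \<exists>m. close k m then b (SOME m. close k m) else \<lfloor>\<xi> * \<alpha> ^ k\<rfloor>)" for k
  have b_near: "\<bar>of_int (b m) - \<beta> ^ m\<bar> \<le> 1" for m
    unfolding b_def by linarith
  \<comment> \<open>The bound 2 adds 1 for closeness and 1 for rounding \<beta>'s power.\<close>
  have a_near: "\<bar>of_int (a k) - \<xi> * \<alpha> ^ k\<bar> \<le> 2" for k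
  proof (cases "\<exists>m. close k m")
    case True
    define m where "m = (SOME m. close k m)"
    have "close k m" unfolding m_def by (rule someI_ex[OF True])
    moreover have "a k = b m" using True by (simp add: a_def m_def)
    ultimately show ?thesis using b_near[of m] unfolding close_def by linarith
  next
    case False
    then have "a k = \<lfloor>\<xi> * \<alpha> ^ k\<rfloor>" unfolding a_def by (rule if_not_P)
    then show ?thesis by linarith
  qed
  have Bseq_a: "Bseq (\<lambda>n. complex_of_int (a n) - of_real \<xi> * of_real \<alpha> ^ n)"
  proof (rule BseqI')
    fix n
    have "complex_of_int (a n) - of_real \<xi> * of_real \<alpha> ^ n = of_real (of_int (a n) - \<xi> * \<alpha> ^ n)"
      by simp
    then show "cmod (complex_of_int (a n) - of_real \<xi> * of_real \<alpha> ^ n) \<le> 2"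
      using a_near[of n] by (simp only: norm_of_real)
  qed
  \<comment> \<open>The factor 1 plays the part of \<xi> in \<open>nearly_geometric\<close>.\<close>
  have Bseq_b: "Bseq (\<lambda>n. complex_of_int (b n) - 1 * of_real \<beta> ^ n)"
  proof (rule BseqI')
    fix n
    have "complex_of_int (b n) - 1 * of_real \<beta> ^ n = of_real (of_int (b n) - \<beta> ^ n)"
      by simp
    then show "cmod (complex_of_int (b n) - 1 * of_real \<beta> ^ n) \<le> 1"
      using b_near[of n] by (simp only: norm_of_real)
  qed
  note A = nearly_geometric[OF Bseq_a] and B = nearly_geometric[OF Bseq_b]
  have inf: "infinite {(k, m). a k = b m}"
  proof
    assume "finite {(k, m). a k = b m}"
    then have "finite (fst ` {(k, m). a k = b m})" by simp
    then obtain N where N: "\<And>k. k \<in> fst ` {(k, m). a k = b m} \<Longrightarrow> k < N"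
      by (metis finite_nat_set_iff_bounded)
    obtain k where "k \<ge> N" "\<exists>m. close k m" using approx[of N] unfolding close_def by blast
    then have "a k = b (SOME m. close k m)" by (simp add: a_def)
    then have "k \<in> fst ` {(k, m). a k = b m}" by force
    with N \<open>k \<ge> N\<close> show False by fastforce
  qed
  \<comment> \<open>This is the bound of \<open>ln_diff_bounded\<close> for \<open>C = 3\<close>,
    the sum of the errors 2 of \<open>a\<close> and 1 of \<open>b\<close>.\<close>
  define D where "D = \<bar>ln (\<xi> + 3)\<bar> + \<bar>ln ((1 + 3) / \<xi>)\<bar>"
  have strip: "\<bar>real k * ln \<alpha> - real m * ln \<beta>\<bar> \<le> D" if "a k = b m" for k m
  proof -
    have "\<bar>\<xi> * \<alpha> ^ k - \<beta> ^ m\<bar> \<le> 3" using a_near[of k] b_near[of m] that by linarith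
    from ln_diff_bounded[OF this \<xi>] show ?thesis
      using assms by (simp add: D_def ln_realpow)
  qed
  have line: "finite ({(int k, int m) | k m. a k = b m} \<inter> L)" if L: "rational_line L" for L
  proof -
    obtain A B C :: int where AB: "A \<noteq> 0 \<or> B \<noteq> 0"
      and L': "\<And>k m. (k, m) \<in> L \<Longrightarrow> A * k + B * m + C = 0"
      using rational_line_int_coeffs[OF L] by metis
    let ?S = "{(k::nat, m::nat). \<bar>real k * ln \<alpha> - real m * ln \<beta>\<bar> \<le> D \<and>
      of_int A * real k + of_int B * real m + of_int C = 0}"
    \<comment> \<open>The transversality quantity is
      \<open>B * ln \<alpha> + A * ln \<beta>\<close>, hence the swapped order in
      \<open>indep\<close>.\<close>
    have "finite ?S"
      using indep[of B A] AB by (intro finite_strip_line pos) auto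
    moreover have "{(int k, int m) | k m. a k = b m} \<inter> L \<subseteq> map_prod int int ` ?S"
    proof clarify
      fix k m assume km: "a k = b m" "(int k, int m) \<in> L"
      have "real_of_int (A * int k + B * int m + C) = of_int 0"
        by (simp only: L'[OF km(2)])
      then have "(k, m) \<in> ?S" using strip[OF km(1)] by simp
      then show "(int k, int m) \<in> map_prod int int ` ?S" by force
    qed
    ultimately show ?thesis by (meson finite_imageI finite_subset)
  qed
  show ?thesis
    using A B \<xi> assms(1,2) inf line
    by (intro exI[of _ "\<lambda>k. of_int (a k)"] exI[of _ "\<lambda>m. of_int (b m)"])
       (auto simp: dominating_root_linear)
qed

end
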